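(* Let $n\ge 4$ and $3\le d\le n-2$, and let $\lambda_2^*=\max\{\lambda_2(T): T\in \mathcal{T}(n,d)\}$. Then $$\lambda_2^* < \sqrt{2+\sqrt{\left(\frac{n-d}{2}\right)^2+4}}.$$
   Context: All graphs are finite and simple. For a graph $G$, $\lambda_2(G)$ is the second largest eigenvalue (with multiplicity) of the adjacency matrix of $G$. $\mathcal{T}(n,d)$ is the set of trees on $n$ vertices with diameter $d$. *)

theory Defs
  imports
    "HOL-Library.Multiset"
    "Jordan_Normal_Form.Char_Poly"
    "Graph_Theory.Graph_Theory"
begin

text \<open>
  A finite simple graph is a \<^locale>\<open>pair_graph\<close>: a finite loop-free digraph without parallel arcs
  whose arc relation is symmetric.  Each undirected edge is a pair of opposite arcs, so
  \<^const>\<open>Digraph_Component.tree\<close> does not describe undirected trees: running along an edge and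
  back is a \<^const>\<open>pre_digraph.cycle\<close> of length 2.  The cycles of the undirected graph are
  those of length at least 3.
\<close>

definition is_tree :: "'a pair_pre_digraph \<Rightarrow> bool" where
  "is_tree G \<longleftrightarrow> pair_graph G \<and> Digraph_Component.connected (with_proj G) \<and>
     \<not> (\<exists>p. pre_digraph.cycle (with_proj G) p \<and> 3 \<le> length p)"

definition distance :: "'a pair_pre_digraph \<Rightarrow> 'a \<Rightarrow> 'a \<Rightarrow> ereal" where
  "distance G u v = wf_digraph.\<mu> (with_proj G) (\<lambda>_. 1) u v"

definition diameter :: "'a pair_pre_digraph \<Rightarrow> ereal" where
  "diameter G = (SUP u\<in>pverts G. SUP v\<in>pverts G. distance G u v)"

text \<open>
  Graphs on \<open>n\<close> vertices are taken with vertex set \<open>{0..<n}\<close>, which also provides the indexing of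
  the adjacency matrix.  Up to isomorphism these are all the graphs on \<open>n\<close> vertices.
\<close>

definition trees :: "nat \<Rightarrow> nat \<Rightarrow> nat pair_pre_digraph set" where
  "trees n d = {G. pverts G = {0..<n} \<and> is_tree G \<and> diameter G = ereal (real d)}"

definition adjacency_matrix :: "nat pair_pre_digraph \<Rightarrow> real mat" where
  "adjacency_matrix G = mat (card (pverts G)) (card (pverts G))
     (\<lambda>(i, j). if (i, j) \<in> parcs G then 1 else 0)"

text \<open>
  The eigenvalues in decreasing order, each repeated according to its multiplicity as a root of
  the characteristic polynomial (for the real symmetric matrices used here all roots are real).
\<close>

definition eigenvalues_desc :: "real mat \<Rightarrow> real list" where
  "eigenvalues_desc A = rev (sorted_list_of_multiset (proots (char_poly A)))"

definition lambda2 :: "nat pair_pre_digraph \<Rightarrow> real" where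
  "lambda2 G = eigenvalues_desc (adjacency_matrix G) ! 1"

lemma finite_trees: "finite (trees n d)"
proof -
  let ?mk = "\<lambda>R. \<lparr>pverts = {0..<n}, parcs = R\<rparr> :: nat pair_pre_digraph"
  have "trees n d \<subseteq> ?mk ` Pow ({0..<n} \<times> {0..<n})"
  proof
    fix G assume G: "G \<in> trees n d"
    then have V: "pverts G = {0..<n}" and "pair_graph G"
      by (auto simp: trees_def is_tree_def)
    then interpret pair_graph G by simp
    have "parcs G \<subseteq> {0..<n} \<times> {0..<n}"
      using in_arcsD1 in_arcsD2 V by auto
    moreover have "G = ?mk (parcs G)"
      using V by simp
    ultimately show "G \<in> ?mk ` Pow ({0..<n} \<times> {0..<n})"
      by blast
  qed
  then show ?thesis
    by (rule finite_subset) simp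
qed

definition lambda2_star :: "nat \<Rightarrow> nat \<Rightarrow> real" where
  "lambda2_star n d = Max {lambda2 T | T. T \<in> trees n d}"

end

theory Submission
  imports Defs "Jordan_Normal_Form.Schur_Decomposition"
begin

text \<open>
  Put \<open>K = (n - d - 1) / 2\<close>.  If \<open>m\<close> bounds the quadratic form of the adjacency matrix on all
  vectors vanishing at one vertex \<open>c\<close>, then \<open>\<lambda>\<^sub>2 \<le> m\<close>.  Root the tree at an end of a diametral path
  \<open>P\<close>; exactly \<open>2 K\<close> vertices lie off \<open>P\<close>, and \<open>c\<close> is a centroid for them, so that after deleting \<open>c\<close>
  every remaining subtree has at most \<open>K\<close> of them.  The extremal configuration is an infinite path
  with \<open>K\<close> pendant vertices at one place: its eigenvalue \<open>\<mu> = t + 1 / t\<close> with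
  \<open>1 / t - t = K / \<mu>\<close> is \<open>sqrt (2 + sqrt (K\<^sup>2 + 4))\<close>.  In general, give a vertex with \<open>s\<close> off-path
  vertices in its subtree the weight \<open>s / \<mu>\<close>, increased by \<open>t\<close> if it lies on \<open>P\<close>; weighted AM-GM on
  the edges with these weights bounds the form by \<open>\<mu>\<close>.  The strict inequality comes from
  \<open>K < (n - d) / 2\<close>.
\<close>

section \<open>The second eigenvalue of a real symmetric matrix\<close>

lemma proots_prod_linear: "proots (\<Prod>a\<leftarrow>xs. [:- a, 1:]) = mset (xs :: 'a::idom list)"
proof (induction xs)
  case (Cons x xs)
  have "(\<Prod>a\<leftarrow>xs. [:- a, 1:]) \<noteq> (0 :: 'a poly)" by (auto simp: prod_list_zero_iff)
  then show ?case using Cons.IH proots_mult[of "[:- x, 1:]" "\<Prod>a\<leftarrow>xs. [:- a, 1:]"] by simp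
qed simp

lemma symmetric_mult_vec_scalar:
  fixes A :: "'a::comm_semiring_0 mat"
  assumes "A \<in> carrier_mat n n" "transpose_mat A = A" "x \<in> carrier_vec n" "y \<in> carrier_vec n"
  shows "(A *\<^sub>v y) \<bullet> x = y \<bullet> (A *\<^sub>v x)"
  using transpose_vec_mult_scalar[of A n n x y] assms by simp

text \<open>Over the complex numbers the polynomial splits. A root \<open>a\<close> with eigenvector
  \<open>v\<close> satisfies \<open>a = conjugate a\<close>, since symmetry and realness evaluate
  the Hermitian form of \<open>A\<close> at \<open>v\<close> in two ways. The factorisation descends
  to the reals because the embedding of polynomials is injective.\<close>

lemma real_symmetric_char_poly_splits:
  fixes A :: "real mat"
  assumes A: "A \<in> carrier_mat n n" and sym: "transpose_mat A = A"
  shows "\<exists>es. char_poly A = (\<Prod>a\<leftarrow>es. [:- a, 1:]) \<and> length es = n"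
proof -
  let ?h = "of_real :: real \<Rightarrow> complex"
  let ?A = "map_mat ?h A"
  have cA: "?A \<in> carrier_mat n n" using A by simp
  have symA: "transpose_mat ?A = ?A" using sym by (metis map_mat_transpose)
  obtain as where as: "char_poly ?A = (\<Prod>a\<leftarrow>as. [:- a, 1:])" "length as = n"
    using char_poly_factorized[OF cA] by blast
  have real: "of_real (Re a) = a" if "a \<in> set as" for a
  proof -
    have "poly (char_poly ?A) a = 0"
      unfolding as(1) poly_prod_list using that by (auto simp: prod_list_zero_iff o_def)
    then have "eigenvalue ?A a" using eigenvalue_root_char_poly[OF cA] by simp
    then obtain v where v: "v \<in> carrier_vec n" "v \<noteq> 0\<^sub>v n" "?A *\<^sub>v v = a \<cdot>\<^sub>v v"
      unfolding eigenvalue_def eigenvector_def using cA by auto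
    have cv: "conjugate v \<in> carrier_vec n" using v(1) by simp
    have Acv: "?A *\<^sub>v conjugate v = conjugate a \<cdot>\<^sub>v conjugate v"
    proof -
      have "?A *\<^sub>v conjugate v = conjugate (?A *\<^sub>v v)"
        using A v(1) by (intro eq_vecI) (auto simp: scalar_prod_def)
      then show ?thesis using v(3) by (simp add: conjugate_smult_vec)
    qed
    have "a * (v \<bullet>c v) = (?A *\<^sub>v v) \<bullet>c v" using v cv by simp
    also have "\<dots> = v \<bullet> (?A *\<^sub>v conjugate v)"
      using symmetric_mult_vec_scalar[OF cA symA cv v(1)] .
    also have "\<dots> = conjugate a * (v \<bullet>c v)" unfolding Acv using v cv by simp
    finally have "a = conjugate a" using v by simp
    then show ?thesis by (simp add: complex_eq_iff)
  qed
  interpret map_poly_inj_idom_hom ?h ..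
  define es where "es = map Re as"
  have "map_poly ?h (char_poly A) = char_poly ?A"
    using of_real_hom.char_poly_hom[OF A] by metis
  also have "\<dots> = (\<Prod>a\<leftarrow>map Re as. [:- of_real a, 1:])"
    unfolding as(1) using real by (intro arg_cong[where f = prod_list]) simp
  also have "\<dots> = map_poly ?h (\<Prod>a\<leftarrow>es. [:- a, 1:])"
    unfolding es_def by (simp add: hom_prod_list o_def)
  finally have "char_poly A = (\<Prod>a\<leftarrow>es. [:- a, 1:])" by simp
  moreover have "length es = n" using as(2) by (simp add: es_def)
  ultimately show ?thesis by blast
qed

text \<open>Covers a repeated eigenvalue as well, where two independent eigenvectors are required. A
  Schur form with \<open>a\<close>, \<open>b\<close> leading the diagonal gives an invariant plane
  spanned by the first two columns of \<open>P\<close>; Gram-Schmidt followed by symmetry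
  diagonalises \<open>A\<close> on it.\<close>

lemma real_symmetric_two_eigenvectors:
  fixes A :: "real mat"
  assumes A: "A \<in> carrier_mat n n" and sym: "transpose_mat A = A"
    and cp: "char_poly A = (\<Prod>a\<leftarrow>a # b # es. [:- a, 1:])"
  obtains p q where "p \<in> carrier_vec n" "q \<in> carrier_vec n" "p \<noteq> 0\<^sub>v n" "q \<noteq> 0\<^sub>v n"
    "A *\<^sub>v p = a \<cdot>\<^sub>v p" "A *\<^sub>v q = b \<cdot>\<^sub>v q" "p \<bullet> q = 0"
proof -
  obtain B P Q where schur: "schur_decomposition A (a # b # es) = (B, P, Q)"
    by (cases "schur_decomposition A (a # b # es)") auto
  from schur_decomposition[OF A cp schur]
  have sim: "similar_mat_wit A B P Q" and ut: "upper_triangular B" and diag: "diag_mat B = a # b # es"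
    by auto
  note w = similar_mat_witD2[OF A sim]
  have len: "length (diag_mat B) = n" using w(5) by (simp add: diag_mat_def)
  with diag have n: "0 < n" "1 < n" by auto
  have Bij: "B $$ (0,0) = a" "B $$ (1,1) = b" "B $$ (1,0) = 0"
    and Bi: "\<And>i j. j < i \<Longrightarrow> i < n \<Longrightarrow> B $$ (i,j) = 0"
  proof -
    have "diag_mat B ! i = B $$ (i,i)" if "i < n" for i
      using w(5) that by (simp add: diag_mat_def)
    from this[OF n(1)] this[OF n(2)] show "B $$ (0,0) = a" "B $$ (1,1) = b"
      unfolding diag by auto
    show "\<And>i j. j < i \<Longrightarrow> i < n \<Longrightarrow> B $$ (i,j) = 0"
      using ut w(5) unfolding upper_triangular_def by auto
    from this[of 0 1] n show "B $$ (1,0) = 0" by auto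
  qed
  define p where "p = col P 0"
  define q0 where "q0 = col P 1"
  have p: "p \<in> carrier_vec n" and q0: "q0 \<in> carrier_vec n"
    unfolding p_def q0_def using w(6) by auto
  have AP: "A * P = P * B"
  proof -
    have "A * P = P * B * (Q * P)"
      unfolding w(3) using w(5-7) by (simp add: assoc_mult_mat[of _ n n _ n _ n])
    then show ?thesis using w by simp
  qed
  have colP: "A *\<^sub>v col P j = P *\<^sub>v col B j" if "j < n" for j
    using col_mult2[OF A w(6) that] col_mult2[OF w(6,5) that] unfolding AP by simp
  have colQ: "Q *\<^sub>v col P j = unit_vec n j" if "j < n" for j
    using col_mult2[OF w(7,6) that] w(2) that by simp
  have Pp: "P *\<^sub>v unit_vec n j = col P j" if "j < n" for j
    using w(6) that by (intro eq_vecI) auto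
  have Ap: "A *\<^sub>v p = a \<cdot>\<^sub>v p"
  proof -
    have "col B 0 = a \<cdot>\<^sub>v unit_vec n 0"
      using w(5) n Bij Bi by (intro eq_vecI) (auto simp: unit_vec_def)
    then show ?thesis unfolding p_def colP[OF n(1)]
      using w(6) Pp[OF n(1)] by (simp add: mult_mat_vec[of _ n n])
  qed
  have Aq0: "A *\<^sub>v q0 = (B $$ (0,1)) \<cdot>\<^sub>v p + b \<cdot>\<^sub>v q0"
  proof -
    have "col B 1 = (B $$ (0,1)) \<cdot>\<^sub>v unit_vec n 0 + b \<cdot>\<^sub>v unit_vec n 1"
    proof (intro eq_vecI)
      fix i assume "i < dim_vec ((B $$ (0,1)) \<cdot>\<^sub>v unit_vec n 0 + b \<cdot>\<^sub>v unit_vec n 1)"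
      then have i: "i < n" by simp
      consider "i = 0" | "i = 1" | "i > 1" by linarith
      then show "col B 1 $ i = ((B $$ (0,1)) \<cdot>\<^sub>v unit_vec n 0 + b \<cdot>\<^sub>v unit_vec n 1) $ i"
        using i w(5) n Bij Bi[of 1 i] by cases (auto simp: unit_vec_def)
    qed (use w(5) in auto)
    then show ?thesis unfolding p_def q0_def colP[OF n(2)]
      using w(6) Pp[OF n(1)] Pp[OF n(2)]
      by (simp add: mult_mat_vec[of _ n n] mult_add_distrib_mat_vec[of _ n n])
  qed
  have p_nz: "p \<noteq> 0\<^sub>v n"
  proof
    assume "p = 0\<^sub>v n"
    then have "unit_vec n 0 = Q *\<^sub>v 0\<^sub>v n" using colQ[OF n(1)] unfolding p_def by simp
    also have "\<dots> = 0\<^sub>v n" using w(7) by (intro eq_vecI) auto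
    finally have "unit_vec n 0 $ 0 = (0\<^sub>v n $ 0 :: real)" by simp
    then show False using n by simp
  qed
  have pp: "p \<bullet> p \<noteq> 0"
    using conjugate_square_eq_0_vec[OF p] p_nz by simp
  \<comment> \<open>The Gram-Schmidt coefficient: the columns of \<open>P\<close> need not be
    orthogonal.\<close>
  define s where "s = - ((p \<bullet> q0) / (p \<bullet> p))"
  define q where "q = q0 + s \<cdot>\<^sub>v p"
  have q: "q \<in> carrier_vec n" unfolding q_def using p q0 by simp
  have orth: "p \<bullet> q = 0"
    unfolding q_def using p q0 pp by (simp add: scalar_prod_add_distrib[of _ n] s_def)
  have q_nz: "q \<noteq> 0\<^sub>v n"
  proof
    assume *: "q = 0\<^sub>v n"
    have "Q *\<^sub>v q = unit_vec n 1 + s \<cdot>\<^sub>v unit_vec n 0"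
      unfolding q_def using w(7) p q0 colQ[OF n(1)] colQ[OF n(2)]
      by (simp add: mult_mat_vec[of _ n n] mult_add_distrib_mat_vec[of _ n n] p_def q0_def)
    moreover have "Q *\<^sub>v q = 0\<^sub>v n" unfolding * using w(7) by (intro eq_vecI) auto
    ultimately have "(unit_vec n 1 + s \<cdot>\<^sub>v unit_vec n 0) $ 1 = (0\<^sub>v n $ 1 :: real)" by simp
    then show False using n by simp
  qed
  \<comment> \<open>The coefficient of \<open>p\<close> in the image of \<open>q\<close>, found by
    substituting \<open>q0 = q - s p\<close>. Symmetry then forces it to vanish, as \<open>p\<close>
    is an eigenvector orthogonal to \<open>q\<close>.\<close>
  define c where "c = B $$ (0,1) - b * s + a * s"
  have Aq: "A *\<^sub>v q = c \<cdot>\<^sub>v p + b \<cdot>\<^sub>v q"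
  proof -
    have "A *\<^sub>v q = (B $$ (0,1)) \<cdot>\<^sub>v p + b \<cdot>\<^sub>v q0 + s \<cdot>\<^sub>v (a \<cdot>\<^sub>v p)"
      unfolding q_def using A p q0 Ap Aq0
      by (simp add: mult_mat_vec[of _ n n] mult_add_distrib_mat_vec[of _ n n])
    also have "\<dots> = c \<cdot>\<^sub>v p + b \<cdot>\<^sub>v q"
      unfolding q_def c_def using p q0 by (intro eq_vecI) (auto simp: algebra_simps)
    finally show ?thesis .
  qed
  have "p \<bullet> (A *\<^sub>v q) = c * (p \<bullet> p)"
    unfolding Aq using p q orth by (simp add: scalar_prod_add_distrib[of _ n])
  moreover have "p \<bullet> (A *\<^sub>v q) = (A *\<^sub>v p) \<bullet> q"
    using symmetric_mult_vec_scalar[OF A sym q p] by simp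
  moreover have "(A *\<^sub>v p) \<bullet> q = 0" unfolding Ap using p q orth by simp
  ultimately have "c = 0" using pp by simp
  then have "A *\<^sub>v q = b \<cdot>\<^sub>v q" unfolding Aq using p q by (intro eq_vecI) auto
  then show ?thesis using that p q p_nz q_nz Ap orth by blast
qed

text \<open>The vanishing coordinate cuts the span of two eigenvectors down to a line on which the
  form is at least the smaller of the two eigenvalues.\<close>

lemma second_eigenvalue_le:
  fixes A :: "real mat"
  assumes A: "A \<in> carrier_mat n n" and sym: "transpose_mat A = A" and n: "2 \<le> n" and c: "c < n"
    and bound: "\<And>x. x \<in> carrier_vec n \<Longrightarrow> x $ c = 0 \<Longrightarrow> x \<bullet> (A *\<^sub>v x) \<le> m * (x \<bullet> x)"
  shows "eigenvalues_desc A ! 1 \<le> m"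
proof -
  define ds where "ds = eigenvalues_desc A"
  obtain es where es: "char_poly A = (\<Prod>a\<leftarrow>es. [:- a, 1:])" "length es = n"
    using real_symmetric_char_poly_splits[OF A sym] by blast
  have "proots (char_poly A) = mset es"
    unfolding es(1) by (rule proots_prod_linear)
  then have mset: "mset ds = mset es"
    unfolding ds_def eigenvalues_desc_def by simp
  have sorted: "sorted (rev ds)" unfolding ds_def eigenvalues_desc_def by simp
  have len: "length ds = n" using mset es(2) by (metis size_mset)
  then obtain a b rs where ds: "ds = a # b # rs"
    using n by (cases ds; cases "tl ds") auto
  have ab: "b \<le> a" using sorted unfolding ds by (auto simp: sorted_append)
  \<comment> \<open>Reordering the linear factors decreasingly makes \<open>a\<close> and
    \<open>b\<close> the two largest eigenvalues.\<close>
  have "char_poly A = prod_mset (image_mset (\<lambda>a. [:- a, 1:]) (mset ds))"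
    unfolding es(1) mset by (metis mset_map prod_mset_prod_list)
  then have "char_poly A = (\<Prod>a\<leftarrow>a # b # rs. [:- a, 1:])"
    unfolding ds[symmetric] by (metis mset_map prod_mset_prod_list)
  then obtain p q where p: "p \<in> carrier_vec n" "p \<noteq> 0\<^sub>v n" "A *\<^sub>v p = a \<cdot>\<^sub>v p"
    and q: "q \<in> carrier_vec n" "q \<noteq> 0\<^sub>v n" "A *\<^sub>v q = b \<cdot>\<^sub>v q" and pq: "p \<bullet> q = 0"
    by (rule real_symmetric_two_eigenvectors[OF A sym])
  have pos: "0 < p \<bullet> p" "0 < q \<bullet> q"
    using conjugate_square_greater_0_vec[OF p(1)] conjugate_square_greater_0_vec[OF q(1)] p q by auto
  obtain s t where st: "s * p $ c + t * q $ c = 0" "s \<noteq> 0 \<or> t \<noteq> 0"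
  proof (cases "q $ c = 0")
    case True then show ?thesis using that[of 0 1] by simp
  next
    case False then show ?thesis using that[of "q $ c" "- p $ c"] by simp
  qed
  define x where "x = s \<cdot>\<^sub>v p + t \<cdot>\<^sub>v q"
  have x: "x \<in> carrier_vec n" unfolding x_def using p q by simp
  have xc: "x $ c = 0" unfolding x_def using p q c st(1) by simp
  have qp: "q \<bullet> p = 0" using pq comm_scalar_prod[OF p(1) q(1)] by simp
  have xx: "x \<bullet> x = s^2 * (p \<bullet> p) + t^2 * (q \<bullet> q)"
    unfolding x_def using p q pq qp
    by (simp add: scalar_prod_add_distrib[of _ n] add_scalar_prod_distrib[of _ n] power2_eq_square)
  have "A *\<^sub>v x = s \<cdot>\<^sub>v (a \<cdot>\<^sub>v p) + t \<cdot>\<^sub>v (b \<cdot>\<^sub>v q)"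
    unfolding x_def using A p q by (simp add: mult_mat_vec[of _ n n] mult_add_distrib_mat_vec[of _ n n])
  then have xAx: "x \<bullet> (A *\<^sub>v x) = a * (s^2 * (p \<bullet> p)) + b * (t^2 * (q \<bullet> q))"
    unfolding x_def using p q pq qp
    by (simp add: scalar_prod_add_distrib[of _ n] add_scalar_prod_distrib[of _ n] power2_eq_square)
  have "b * (x \<bullet> x) \<le> x \<bullet> (A *\<^sub>v x)"
    unfolding xx xAx using mult_right_mono[OF ab, of "s^2 * (p \<bullet> p)"] pos by (simp add: distrib_left)
  also have "\<dots> \<le> m * (x \<bullet> x)" using bound[OF x xc] .
  finally have "b * (x \<bullet> x) \<le> m * (x \<bullet> x)" .
  moreover have "0 < x \<bullet> x"
    unfolding xx using st(2) pos by (auto intro: add_pos_nonneg add_nonneg_pos)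
  ultimately have "b \<le> m" by simp
  then show ?thesis using ds unfolding ds_def by simp
qed

section \<open>The edge form of a rooted tree\<close>

text \<open>Edges are the pairs of a non-root vertex and its parent, so each edge is named by its
  lower end. Nothing is assumed about the parent of the root; \<open>depth\<close> rules out
  cycles.\<close>

locale rooted_tree =
  fixes V :: "'a set" and root :: 'a and parent :: "'a \<Rightarrow> 'a" and depth :: "'a \<Rightarrow> nat"
  assumes finite_verts: "finite V" and root_in: "root \<in> V"
    and parent_in: "w \<in> V \<Longrightarrow> w \<noteq> root \<Longrightarrow> parent w \<in> V"
    and depth_root: "depth root = 0"
    and depth_eq_Suc: "w \<in> V \<Longrightarrow> w \<noteq> root \<Longrightarrow> depth w = Suc (depth (parent w))"
begin

lemma depth_parent: "w \<in> V \<Longrightarrow> w \<noteq> root \<Longrightarrow> depth (parent w) < depth w"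
  using depth_eq_Suc by simp

text \<open>\<open>E\<close> lists the retained edges by their lower ends. The whole tree is
  \<open>E = V - {root}\<close>, and deleting edges or a vertex means shrinking
  \<open>E\<close>.\<close>

definition up :: "'a set \<Rightarrow> 'a rel" where
  "up E = {(w, parent w) | w. w \<in> E}"

definition subtree :: "'a set \<Rightarrow> 'a \<Rightarrow> 'a set" where
  "subtree E v = {z \<in> V. (z, v) \<in> (up E)\<^sup>*}"

lemma finite_subtree: "finite (subtree E v)"
  using finite_verts by (simp add: subtree_def)

lemma up_rtrancl_comparable:
  "(z, v) \<in> (up E)\<^sup>* \<Longrightarrow> (z, w) \<in> (up E)\<^sup>* \<Longrightarrow> (v, w) \<in> (up E)\<^sup>* \<or> (w, v) \<in> (up E)\<^sup>*"
  by (rule single_valued_confluent) (auto simp: single_valued_def up_def)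

lemma depth_up_rtrancl:
  assumes "(z, v) \<in> (up E)\<^sup>*" "E \<subseteq> V - {root}"
  shows "z = v \<or> depth v < depth z"
  using assms(1)
proof (induction rule: rtrancl_induct)
  case (step y w)
  then have "depth w < depth y" using assms(2) depth_parent by (auto simp: up_def)
  then show ?case using step.IH by auto
qed simp

text \<open>A common descendant would make the two siblings comparable. Climbing from one to the
  other would pass through their common parent, which already has smaller depth than both.\<close>

lemma subtree_children_disjoint:
  assumes E: "E \<subseteq> V - {root}" and w: "w \<in> E" "w' \<in> E" "parent w = parent w'" "w \<noteq> w'"
  shows "subtree E w \<inter> subtree E w' = {}"
proof -
  have no: "(a, b) \<notin> (up E)\<^sup>*" if ab: "a \<in> E" "b \<in> E" "parent a = parent b" "a \<noteq> b" for a b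
  proof
    assume "(a, b) \<in> (up E)\<^sup>*"
    then have "(parent a, b) \<in> (up E)\<^sup>*"
      using ab by (cases rule: converse_rtranclE) (auto simp: up_def)
    then have "parent b = b \<or> depth b < depth (parent b)"
      using depth_up_rtrancl[OF _ E] ab(3) by metis
    moreover have "depth (parent b) < depth b" using depth_parent ab E by blast
    ultimately show False by auto
  qed
  show ?thesis
    using no[OF w] no[of w' w] w up_rtrancl_comparable unfolding subtree_def by auto
qed

lemma subtree_child_subset:
  assumes E: "E \<subseteq> V - {root}" and w: "w \<in> E" "parent w = v"
  shows "subtree E w \<subseteq> subtree E v - {v}"
proof -
  have "(w, v) \<in> up E" using w by (auto simp: up_def)
  moreover have "v \<notin> subtree E w"
  proof
    assume "v \<in> subtree E w"
    then have "v = w \<or> depth w < depth v"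
      using depth_up_rtrancl[OF _ E] by (auto simp: subtree_def)
    moreover have "depth v < depth w" using depth_parent w E by blast
    ultimately show False by auto
  qed
  ultimately show ?thesis by (auto simp: subtree_def intro: rtrancl_into_rtrancl)
qed

text \<open>The counting budget for the weights. Removing \<open>v\<close> on the right gains one
  exactly when \<open>v\<close> lies in \<open>X\<close>, and this gain is what makes the estimate
  at vertices off the path work.\<close>

lemma sum_card_subtree_children:
  assumes E: "E \<subseteq> V - {root}"
  shows "(\<Sum>w | w \<in> E \<and> parent w = v. card (subtree E w \<inter> X)) \<le> card (subtree E v \<inter> X - {v})"
proof -
  let ?C = "{w. w \<in> E \<and> parent w = v}"
  have "finite E" using E finite_verts by (meson finite_Diff finite_subset)
  then have fin: "finite ?C" by simp
  have "(\<Sum>w\<in>?C. card (subtree E w \<inter> X)) = card (\<Union>w\<in>?C. subtree E w \<inter> X)"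
  proof (intro card_UN_disjoint[symmetric] fin ballI impI)
    fix w w' assume "w \<in> ?C" "w' \<in> ?C" "w \<noteq> w'"
    then have "subtree E w \<inter> subtree E w' = {}"
      using subtree_children_disjoint[OF E, of w w'] by simp
    then show "subtree E w \<inter> X \<inter> (subtree E w' \<inter> X) = {}" by blast
  qed (simp add: finite_subtree)
  also have "\<dots> \<le> card (subtree E v \<inter> X - {v})"
    using subtree_child_subset[OF E] by (intro card_mono) (auto simp: finite_subtree)
  finally show ?thesis .
qed

text \<open>The deepest vertex whose subtree carries at least half of \<open>X\<close> is a centroid for \<open>X\<close>.\<close>

lemma centroid:
  fixes X :: "'a set"
  assumes X: "X \<subseteq> V"
  obtains c where "c \<in> V" and
    "\<And>v. v \<in> V \<Longrightarrow> v \<noteq> c \<Longrightarrow>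
      2 * card (subtree {w \<in> V - {root}. w \<noteq> c \<and> parent w \<noteq> c} v \<inter> X) \<le> card X"
proof -
  let ?E = "V - {root}"
  have finX: "finite X" using X finite_verts finite_subset by blast
  have to_root: "(z, root) \<in> (up ?E)\<^sup>*" if "z \<in> V" for z
    using that
  proof (induction "depth z" arbitrary: z rule: less_induct)
    case less
    show ?case
    proof (cases "z = root")
      case False
      then have "(z, parent z) \<in> up ?E" using less.prems by (auto simp: up_def)
      moreover have "(parent z, root) \<in> (up ?E)\<^sup>*"
        using less.hyps depth_parent parent_in less.prems False by blast
      ultimately show ?thesis by (rule converse_rtrancl_into_rtrancl)
    qed simp
  qed
  \<comment> \<open>The candidates. The root is one because its subtree is all of \<open>V\<close>,
    so a deepest candidate exists.\<close>
  define H where "H = {v \<in> V. card X \<le> 2 * card (subtree ?E v \<inter> X)}"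
  have "subtree ?E root = V" using to_root by (auto simp: subtree_def)
  then have "root \<in> H" unfolding H_def using root_in X by (simp add: Int_absorb1)
  moreover have "finite H" unfolding H_def using finite_verts by simp
  ultimately obtain c where c: "c \<in> H" "\<And>v. v \<in> H \<Longrightarrow> depth v \<le> depth c"
    by (metis arg_max_on_def arg_max_nat_lemma[of "\<lambda>v. v \<in> H" root depth "Suc (Max (depth ` H))"]
        empty_iff finite_imageI image_eqI Max_ge le_imp_less_Suc)
  define F where "F = {w \<in> V - {root}. w \<noteq> c \<and> parent w \<noteq> c}"
  have FE: "up F \<subseteq> up ?E" unfolding F_def up_def by auto
  have "2 * card (subtree F v \<inter> X) \<le> card X" if v: "v \<in> V" "v \<noteq> c" for v
  proof (cases "(v, c) \<in> (up ?E)\<^sup>*")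
    case True
    \<comment> \<open>A vertex strictly below \<open>c\<close> is too deep to be a
      candidate.\<close>
    then have "depth c < depth v" using depth_up_rtrancl[of v c ?E] v by auto
    then have "v \<notin> H" using c(2) by (meson not_le)
    then have "2 * card (subtree ?E v \<inter> X) < card X" using v unfolding H_def by auto
    moreover have "subtree F v \<subseteq> subtree ?E v"
      using rtrancl_mono[OF FE] by (auto simp: subtree_def)
    then have "card (subtree F v \<inter> X) \<le> card (subtree ?E v \<inter> X)"
      by (intro card_mono) (auto simp: finite_subtree)
    ultimately show ?thesis by simp
  next
    case False
    \<comment> \<open>Otherwise a climb to \<open>v\<close> would start below \<open>c\<close> and
      have to leave the subtree of \<open>c\<close> through \<open>c\<close>, whose upward edge is
      missing from \<open>F\<close>. Hence what hangs at \<open>v\<close> misses the half of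
      \<open>X\<close> carried by \<open>c\<close>.\<close>
    have "(z, c) \<notin> (up ?E)\<^sup>*" if "(z, v) \<in> (up F)\<^sup>*" for z
      using that
    proof (induction rule: converse_rtrancl_induct)
      case (step y z)
      then have y: "z = parent y" "y \<noteq> c" by (auto simp: up_def F_def)
      show ?case
      proof
        assume "(y, c) \<in> (up ?E)\<^sup>*"
        then have "(parent y, c) \<in> (up ?E)\<^sup>*"
          using y by (cases rule: converse_rtranclE) (auto simp: up_def)
        then show False using step y by simp
      qed
    qed (use False in simp)
    then have "subtree F v \<inter> X \<inter> (subtree ?E c \<inter> X) = {}" by (auto simp: subtree_def)
    then have "card (subtree F v \<inter> X) + card (subtree ?E c \<inter> X)
        = card ((subtree F v \<inter> X) \<union> (subtree ?E c \<inter> X))"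
      by (intro card_Un_disjoint[symmetric]) (auto simp: finite_subtree)
    also have "\<dots> \<le> card X" using finX by (intro card_mono) auto
    finally show ?thesis using c(1) unfolding H_def by auto
  qed
  then show ?thesis using that[of c] c(1) unfolding F_def H_def by blast
qed

text \<open>\<open>P\<close> consists of \<open>v\<close> and its ancestors. Closure under parents
  and injectivity of \<open>parent\<close> are the form in which the path is used later: a vertex
  has at most one child on \<open>P\<close>, and a vertex off \<open>P\<close> has none.\<close>

lemma root_path:
  assumes v: "v \<in> V"
  obtains P where "P \<subseteq> V" "\<And>w. w \<in> P \<Longrightarrow> w \<noteq> root \<Longrightarrow> parent w \<in> P"
    "inj_on parent (P - {root})" "depth v < card P"
proof -
  let ?E = "V - {root}"
  define P where "P = {w \<in> V. (v, w) \<in> (up ?E)\<^sup>*}"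
  have closed: "parent w \<in> P" if "w \<in> P" "w \<noteq> root" for w
    using that parent_in unfolding P_def
    by (auto intro: rtrancl_into_rtrancl[of v w] simp: up_def)
  have "inj_on parent (P - {root})"
  proof (rule inj_onI, rule ccontr)
    fix a b assume ab: "a \<in> P - {root}" "b \<in> P - {root}" "parent a = parent b" "a \<noteq> b"
    then have "v \<in> subtree ?E a \<inter> subtree ?E b" using v by (simp add: P_def subtree_def)
    then show False using subtree_children_disjoint[of ?E a b] ab by (auto simp: P_def)
  qed
  moreover have "{..depth v} \<subseteq> depth ` P"
  proof
    fix k assume "k \<in> {..depth v}"
    then have "k \<le> depth v" by simp
    then show "k \<in> depth ` P"
    proof (induction rule: inc_induct)
      case base
      show ?case using v by (simp add: P_def)
    next
      case (step k)
      then obtain w where w: "w \<in> P" "depth w = Suc k" by auto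
      then have "w \<noteq> root" using depth_root by auto
      then have "depth (parent w) = k" "parent w \<in> P"
        using w closed depth_eq_Suc[of w] by (auto simp: P_def)
      then show ?case by blast
    qed
  qed
  then have "card {..depth v} \<le> card P"
    using finite_verts by (intro surj_card_le) (auto simp: P_def)
  then have "depth v < card P" by simp
  ultimately show ?thesis using that[of P] closed by (auto simp: P_def)
qed

text \<open>Weighted AM-GM on each edge: \<open>r w\<close> plays the role of the ratio of a positive test vector at
  \<open>w\<close> and at its parent.\<close>

lemma edge_form_le:
  fixes r x :: "'a \<Rightarrow> real"
  assumes E: "E \<subseteq> V - {root}" and pos: "\<And>w. w \<in> E \<Longrightarrow> 0 < r w"
    and bound: "\<And>v. v \<in> V \<Longrightarrow> x v \<noteq> 0 \<Longrightarrow>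
      (if v \<in> E then 1 / r v else 0) + (\<Sum>w | w \<in> E \<and> parent w = v. r w) \<le> \<mu>"
  shows "2 * (\<Sum>w\<in>E. x w * x (parent w)) \<le> \<mu> * (\<Sum>v\<in>V. (x v)\<^sup>2)"
proof -
  have finE: "finite E" using E finite_verts by (meson finite_Diff finite_subset)
  have "2 * (\<Sum>w\<in>E. x w * x (parent w))
      \<le> (\<Sum>w\<in>E. (x w)\<^sup>2 / r w + r w * (x (parent w))\<^sup>2)"
    unfolding sum_distrib_left
  proof (rule sum_mono)
    fix w assume "w \<in> E"
    then have r: "0 < r w" by (rule pos)
    \<comment> \<open>AM-GM as a completed square, divided by the positive weight.\<close>
    have "0 \<le> (x w - r w * x (parent w))\<^sup>2 / r w" using r by simp
    also have "\<dots> = (x w)\<^sup>2 / r w + r w * (x (parent w))\<^sup>2 - 2 * (x w * x (parent w))"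
      using r by (simp add: field_simps power2_eq_square)
    finally show "2 * (x w * x (parent w)) \<le> (x w)\<^sup>2 / r w + r w * (x (parent w))\<^sup>2" by simp
  qed
  \<comment> \<open>Regrouping by vertices: \<open>v\<close> receives \<open>1 / r v\<close> from
    its upward edge and \<open>r w\<close> from each child \<open>w\<close>.\<close>
  also have "\<dots> = (\<Sum>v\<in>V. (x v)\<^sup>2 * (if v \<in> E then 1 / r v else 0))
      + (\<Sum>v\<in>V. \<Sum>w | w \<in> E \<and> parent w = v. r w * (x (parent w))\<^sup>2)"
  proof -
    have "(\<Sum>w\<in>E. (x w)\<^sup>2 / r w) = (\<Sum>v\<in>V. (x v)\<^sup>2 * (if v \<in> E then 1 / r v else 0))"
      using E finite_verts by (intro sum.mono_neutral_cong_left) auto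
    moreover have "(\<Sum>w\<in>E. r w * (x (parent w))\<^sup>2)
        = (\<Sum>v\<in>V. \<Sum>w | w \<in> E \<and> parent w = v. r w * (x (parent w))\<^sup>2)"
      using E parent_in by (intro sum.group[symmetric] finE finite_verts) auto
    ultimately show ?thesis by (simp add: sum.distrib)
  qed
  also have "\<dots> = (\<Sum>v\<in>V. (x v)\<^sup>2 *
      ((if v \<in> E then 1 / r v else 0) + (\<Sum>w | w \<in> E \<and> parent w = v. r w)))"
    unfolding sum.distrib[symmetric]
    by (intro sum.cong refl) (simp add: distrib_left sum_distrib_left mult.commute)
  also have "\<dots> \<le> (\<Sum>v\<in>V. (x v)\<^sup>2 * \<mu>)"
  proof (rule sum_mono)
    fix v assume "v \<in> V"
    then show "(x v)\<^sup>2 * ((if v \<in> E then 1 / r v else 0) + (\<Sum>w | w \<in> E \<and> parent w = v. r w))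
        \<le> (x v)\<^sup>2 * \<mu>"
      using bound[of v] by (cases "x v = 0") (auto intro: mult_left_mono)
  qed
  also have "\<dots> = \<mu> * (\<Sum>v\<in>V. (x v)\<^sup>2)"
    by (simp add: sum_distrib_left mult.commute)
  finally show ?thesis .
qed

text \<open>The weights \<open>r\<close> are checked vertex by vertex. On \<open>P\<close> the
  children weigh at most \<open>r v\<close>, and \<open>r v\<close> lies between \<open>t\<close>
  and \<open>1 / t\<close>, the two solutions of \<open>z + 1 / z = \<mu>\<close>. Off
  \<open>P\<close> the condition reduces to \<open>(s - 1) (\<mu>^2 - s) \<ge> 0\<close>. The
  centroid escapes the check since \<open>x\<close> vanishes there.\<close>

lemma edge_form_le_without_centroid:
  fixes t \<mu> K :: real
  assumes P: "P \<subseteq> V" "\<And>w. w \<in> P \<Longrightarrow> w \<noteq> root \<Longrightarrow> parent w \<in> P"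
      "inj_on parent (P - {root})"
    and K: "real (card (V - P)) \<le> 2 * K"
    and t: "0 < t" "0 < \<mu>" "1 / t + t = \<mu>" "1 / t - t = K / \<mu>" "K \<le> \<mu>\<^sup>2"
  shows "\<exists>c\<in>V. \<forall>x. x c = 0 \<longrightarrow>
    2 * (\<Sum>w\<in>V - {root}. x w * x (parent w)) \<le> \<mu> * (\<Sum>v\<in>V. (x v)\<^sup>2)"
proof -
  obtain c where c: "c \<in> V" "\<And>v. v \<in> V \<Longrightarrow> v \<noteq> c \<Longrightarrow>
      2 * card (subtree {w \<in> V - {root}. w \<noteq> c \<and> parent w \<noteq> c} v \<inter> (V - P)) \<le> card (V - P)"
    using centroid[of "V - P"] by blast
  \<comment> \<open>The edges left after deleting \<open>c\<close>: both its upward edge and those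
    to its children go.\<close>
  define E where "E = {w \<in> V - {root}. w \<noteq> c \<and> parent w \<noteq> c}"
  have E: "E \<subseteq> V - {root}" unfolding E_def by auto
  define s where "s v = card (subtree E v \<inter> (V - P))" for v
  define r where "r v = real (s v) / \<mu> + (if v \<in> P then t else 0)" for v
  have sK: "real (s v) \<le> K" if "v \<in> V" "v \<noteq> c" for v
    using c(2)[OF that] K unfolding s_def E_def by linarith
  have self: "v \<in> subtree E v" if "v \<in> V" for v using that by (simp add: subtree_def)
  have s1: "1 \<le> s v" if "v \<in> V" "v \<notin> P" for v
  proof -
    have "subtree E v \<inter> (V - P) \<noteq> {}" using self that by blast
    then show ?thesis unfolding s_def using finite_subtree by (simp add: Suc_leI card_gt_0_iff)
  qed
  have r_pos: "0 < r v" if "v \<in> V" for v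
    using s1[OF that] t unfolding r_def by (cases "v \<in> P") (auto intro: add_nonneg_pos)
  have finC: "finite {w. w \<in> E \<and> parent w = v}" for v
    using E finite_verts by (metis (mono_tags, lifting) finite_Diff finite_subset mem_Collect_eq subsetI subset_eq)
  have bound: "(if v \<in> E then 1 / r v else 0) + (\<Sum>w | w \<in> E \<and> parent w = v. r w) \<le> \<mu>"
    if v: "v \<in> V" "v \<noteq> c" for v
  proof -
    let ?C = "{w. w \<in> E \<and> parent w = v}"
    have split: "(\<Sum>w\<in>?C. r w) = real (\<Sum>w\<in>?C. s w) / \<mu> + (\<Sum>w\<in>?C. if w \<in> P then t else 0)"
      unfolding r_def by (simp add: sum.distrib sum_divide_distrib)
    have sC: "(\<Sum>w\<in>?C. s w) \<le> card (subtree E v \<inter> (V - P) - {v})"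
      unfolding s_def by (rule sum_card_subtree_children[OF E])
    \<comment> \<open>Treats the root and the children of \<open>c\<close>, which have no upward
      edge in \<open>E\<close>, together with all other vertices.\<close>
    have le: "(if v \<in> E then 1 / r v else 0) \<le> 1 / r v" using r_pos[OF v(1)] by simp
    show ?thesis
    proof (cases "v \<in> P")
      case True
      have "(\<Sum>w\<in>?C. if w \<in> P then t else 0) = t * card (?C \<inter> P)"
        using finC by (simp add: sum.If_cases)
      also have "\<dots> \<le> t"
      proof -
        have "inj_on parent (?C \<inter> P)" using P(3) E by (auto intro: inj_on_subset)
        then have "card (?C \<inter> P) \<le> card {v}" by (rule card_inj_on_le) auto
        then show ?thesis using t by simp
      qed
      finally have "(\<Sum>w\<in>?C. if w \<in> P then t else 0) \<le> t" .
      moreover have "(\<Sum>w\<in>?C. s w) \<le> s v"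
        using sC True unfolding s_def by (simp add: Diff_insert_absorb insert_absorb) 
      then have "real (\<Sum>w\<in>?C. s w) / \<mu> \<le> real (s v) / \<mu>"
        using t(2) by (intro divide_right_mono of_nat_mono) auto
      ultimately have sum: "(\<Sum>w\<in>?C. r w) \<le> r v" unfolding split using True by (simp add: r_def)
      have lo: "t \<le> r v" unfolding r_def using True t by simp
      have "real (s v) / \<mu> \<le> K / \<mu>" using sK[OF v] t(2) by (intro divide_right_mono) auto
      then have hi: "r v \<le> 1 / t" unfolding r_def using True t(4) by simp
      \<comment> \<open>Expanding gives \<open>r v + 1 / r v \<le> \<mu>\<close>, because
        \<open>t\<close> and \<open>1 / t\<close> have sum \<open>\<mu>\<close> and product
        1.\<close>
      have "0 \<le> (r v - t) * (1 / t - r v)" using lo hi by simp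
      also have "\<dots> = r v * \<mu> - (r v)\<^sup>2 - 1"
        unfolding t(3)[symmetric] using t(1) by (simp add: field_simps power2_eq_square)
      finally have "1 + (r v)\<^sup>2 \<le> r v * \<mu>" by simp
      then have "1 / r v + r v \<le> \<mu>"
        using r_pos[OF v(1)] by (simp add: field_simps power2_eq_square)
      then show ?thesis using le sum by linarith
    next
      case False
      then have "?C \<inter> P = {}" using P(2) E by auto
      then have "(\<Sum>w\<in>?C. if w \<in> P then t else 0) = 0" by (intro sum.neutral) auto
      \<comment> \<open>Off the path, \<open>v\<close> is itself one of the vertices counted by
        \<open>s v\<close> but lies in no child's subtree.\<close>
      moreover have "(\<Sum>w\<in>?C. s w) \<le> s v - 1"
        using sC self[OF v(1)] False v(1) unfolding s_def by (simp add: finite_subtree)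
      then have "real (\<Sum>w\<in>?C. s w) \<le> real (s v) - 1"
        using s1[OF v(1) False] by linarith
      then have "real (\<Sum>w\<in>?C. s w) / \<mu> \<le> (real (s v) - 1) / \<mu>"
        using t(2) by (intro divide_right_mono) auto
      ultimately have sum: "(\<Sum>w\<in>?C. r w) \<le> (real (s v) - 1) / \<mu>" unfolding split by simp
      define \<sigma> where "\<sigma> = real (s v)"
      have \<sigma>: "1 \<le> \<sigma>" "\<sigma> \<le> \<mu>\<^sup>2"
        using s1[OF v(1) False] sK[OF v] t(5) unfolding \<sigma>_def by auto
      have "0 \<le> (\<sigma> - 1) * (\<mu>\<^sup>2 - \<sigma>) / (\<sigma> * \<mu>)" using \<sigma> t(2) by simp
      also have "\<dots> = \<mu> - (1 / (\<sigma> / \<mu>) + (\<sigma> - 1) / \<mu>)"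
        using \<sigma> t(2) by (simp add: field_simps power2_eq_square)
      finally have "1 / r v + (real (s v) - 1) / \<mu> \<le> \<mu>"
        unfolding r_def \<sigma>_def using False by simp
      then show ?thesis using le sum by linarith
    qed
  qed
  have "2 * (\<Sum>w\<in>V - {root}. x w * x (parent w)) \<le> \<mu> * (\<Sum>v\<in>V. (x v)\<^sup>2)" if x: "x c = 0" for x
  proof -
    \<comment> \<open>The edges at \<open>c\<close> contribute nothing as
      \<open>x c = 0\<close>.\<close>
    have "(\<Sum>w\<in>V - {root}. x w * x (parent w)) = (\<Sum>w\<in>E. x w * x (parent w))"
      using finite_verts x unfolding E_def by (intro sum.mono_neutral_right) auto
    moreover have "2 * (\<Sum>w\<in>E. x w * x (parent w)) \<le> \<mu> * (\<Sum>v\<in>V. (x v)\<^sup>2)"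
    proof (rule edge_form_le[OF E])
      fix w assume "w \<in> E"
      then show "0 < r w" using r_pos E by blast
    next
      fix v assume "v \<in> V" "x v \<noteq> 0"
      then show "(if v \<in> E then 1 / r v else 0) + (\<Sum>w | w \<in> E \<and> parent w = v. r w) \<le> \<mu>"
        using bound x by blast
    qed
    ultimately show ?thesis by simp
  qed
  then show ?thesis using c(1) by blast
qed

end

text \<open>Adding and subtracting the two equations gives \<open>1 / t\<close> and \<open>t\<close>
  as half of \<open>\<mu> + K / \<mu>\<close> and of \<open>\<mu> - K / \<mu>\<close>. These are
  reciprocal exactly when \<open>\<mu>^4 - K^2 = 4 \<mu>^2\<close>, the equation solved by this
  \<open>\<mu>\<close>.\<close>

lemma decay_rate_exists:
  fixes K :: real
  assumes K: "0 \<le> K"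
  defines "\<mu> \<equiv> sqrt (2 + sqrt (K\<^sup>2 + 4))"
  shows "\<exists>t. 0 < t \<and> 1 / t + t = \<mu> \<and> 1 / t - t = K / \<mu>" and "0 < \<mu>" and "K \<le> \<mu>\<^sup>2"
proof -
  define q where "q = sqrt (K\<^sup>2 + 4)"
  have q: "q\<^sup>2 = K\<^sup>2 + 4" "0 \<le> q" unfolding q_def by auto
  have Kq: "K < q" unfolding q_def by (rule real_less_rsqrt) simp
  have \<mu>2: "\<mu>\<^sup>2 = 2 + q" unfolding \<mu>_def q_def[symmetric] using q by simp
  show \<mu>: "0 < \<mu>" unfolding \<mu>_def q_def[symmetric] using q by simp
  show "K \<le> \<mu>\<^sup>2" unfolding \<mu>2 using Kq by simp
  define t where "t = (\<mu> - K / \<mu>) / 2"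
  have tp: "t * ((\<mu> + K / \<mu>) / 2) = 1"
  proof -
    have "(\<mu>\<^sup>2)\<^sup>2 - K\<^sup>2 = 4 * \<mu>\<^sup>2"
      unfolding \<mu>2 using q by (simp add: power2_eq_square algebra_simps)
    then have "(\<mu>\<^sup>2 - K) * (\<mu>\<^sup>2 + K) = 4 * \<mu>\<^sup>2" by (simp add: power2_eq_square algebra_simps)
    then show ?thesis unfolding t_def using \<mu> by (simp add: field_simps power2_eq_square)
  qed
  have "0 < (\<mu> + K / \<mu>) / 2" using \<mu> K by (simp add: add_pos_nonneg)
  moreover have "0 < t * ((\<mu> + K / \<mu>) / 2)" unfolding tp by simp
  ultimately have "0 < t" by (metis zero_less_mult_pos2)
  moreover from this have inv: "1 / t = (\<mu> + K / \<mu>) / 2" using tp by (simp add: field_simps)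
  have "1 / t + t = \<mu>" "1 / t - t = K / \<mu>" unfolding inv by (simp_all add: t_def field_simps)
  ultimately show "\<exists>t. 0 < t \<and> 1 / t + t = \<mu> \<and> 1 / t - t = K / \<mu>" by blast
qed

section \<open>Trees as rooted trees\<close>

lemma relpow_imp_awalk:
  assumes "pair_wf_digraph G" "u \<in> pverts G" "(u, v) \<in> parcs G ^^ k"
  shows "\<exists>p. pre_digraph.awalk (with_proj G) u p v \<and> length p = k"
proof -
  interpret pair_wf_digraph G by fact
  show ?thesis using assms(2,3)
  proof (induction k arbitrary: u)
    case 0
    then show ?case by (auto simp: awalk_Nil_iff)
  next
    case (Suc k)
    obtain w where w: "(u, w) \<in> parcs G" "(w, v) \<in> parcs G ^^ k"
      using relpow_Suc_D2[OF Suc.prems(2)] by blast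
    then obtain p where "awalk w p v" "length p = k"
      using Suc.IH in_arcsD2 by blast
    then have "awalk u ((u, w) # p) v \<and> length ((u, w) # p) = Suc k"
      using w by (simp add: awalk_Cons_iff)
    then show ?case by blast
  qed
qed

lemma awalk_imp_relpow:
  assumes "pair_wf_digraph G" "pre_digraph.awalk (with_proj G) u p v"
  shows "(u, v) \<in> parcs G ^^ length p"
proof -
  interpret pair_wf_digraph G by fact
  show ?thesis using assms(2)
  proof (induction p arbitrary: u)
    case (Cons e p)
    then have "(fst e, snd e) \<in> parcs G" "u = fst e" "(snd e, v) \<in> parcs G ^^ length p"
      by (auto simp: awalk_Cons_iff)
    then show ?case by (metis length_Cons relpow_Suc_I2)
  qed (simp add: awalk_Nil_iff)
qed

lemma distance_conv:
  assumes "pair_wf_digraph G"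
  shows "distance G u v = (INF p\<in>{p. pre_digraph.awalk (with_proj G) u p v}. ereal (real (length p)))"
proof -
  interpret pair_wf_digraph G by fact
  have "awalk_cost (\<lambda>_. 1) p = real (length p)" for p :: "('a \<times> 'a) list"
    by (induction p) auto
  then show ?thesis unfolding distance_def \<mu>_def by simp
qed

lemma distance_le:
  assumes "pair_wf_digraph G" "u \<in> pverts G" "(u, v) \<in> parcs G ^^ k"
  shows "distance G u v \<le> ereal (real k)"
  using relpow_imp_awalk[OF assms] unfolding distance_conv[OF assms(1)]
  by (auto intro: INF_lower2)

lemma distance_ge:
  assumes "pair_wf_digraph G" "\<And>k. (u, v) \<in> parcs G ^^ k \<Longrightarrow> m \<le> k"
  shows "ereal (real m) \<le> distance G u v"
  using assms(2) awalk_imp_relpow[OF assms(1)] unfolding distance_conv[OF assms(1)]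
  by (intro INF_greatest) auto

text \<open>Each of the two nested suprema ranges over a finite nonempty set and is therefore a
  maximum.\<close>

lemma diameter_attained:
  assumes "finite (pverts G)" "pverts G \<noteq> {}"
  obtains u v where "u \<in> pverts G" "v \<in> pverts G" "distance G u v = diameter G"
proof -
  let ?V = "pverts G"
  have attained: "\<exists>x\<in>?V. f x = (SUP x\<in>?V. f x)" for f :: "'a \<Rightarrow> ereal"
  proof -
    have "Max (f ` ?V) \<in> f ` ?V" using assms by (intro Max_in) auto
    then obtain x where "x \<in> ?V" "f x = Max (f ` ?V)" by (metis imageE)
    then show ?thesis using assms by (auto simp: cSup_eq_Max)
  qed
  obtain u where u: "u \<in> ?V" "(SUP v\<in>?V. distance G u v) = diameter G"
    using attained[of "\<lambda>u. SUP v\<in>?V. distance G u v"] unfolding diameter_def by blast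
  obtain v where "v \<in> ?V" "distance G u v = (SUP v\<in>?V. distance G u v)"
    using attained by blast
  then show ?thesis using that u by simp
qed

section \<open>Connectivity, bridges and the rooting of a tree\<close>

lemma is_tree_rtrancl:
  assumes T: "is_tree G" and uv: "u \<in> pverts G" "v \<in> pverts G"
  shows "(u, v) \<in> (parcs G)\<^sup>*"
proof -
  interpret pair_graph G using T by (simp add: is_tree_def)
  have "Digraph_Component.connected (with_proj G)" using T by (simp add: is_tree_def)
  then have "u \<rightarrow>\<^sup>*\<^bsub>with_proj (mk_symmetric (with_proj G))\<^esub> v"
    using uv by (auto simp: connected_def strongly_connected_def)
  then have "u \<rightarrow>\<^sup>*\<^bsub>with_proj G\<^esub> v" using reachable_mk_symmetric_eq[OF pair_sym_arcs] by simp
  then obtain p where "awalk u p v" unfolding reachable_awalk by blast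
  then show ?thesis using awalk_imp_relpow[of G u p v] pair_wf_digraph relpow_imp_rtrancl by blast
qed

text \<open>A walk from \<open>b\<close> back to \<open>a\<close> avoiding the edge shortens to a
  path, which the arc \<open>(a, b)\<close> closes to a cycle.\<close>

lemma is_tree_bridge:
  assumes T: "is_tree G" and ab: "(a, b) \<in> parcs G"
  shows "(b, a) \<notin> (parcs G - {(a, b), (b, a)})\<^sup>*"
proof
  assume "(b, a) \<in> (parcs G - {(a, b), (b, a)})\<^sup>*"
  interpret pair_graph G using T by (simp add: is_tree_def)
  define H where "H = \<lparr>pverts = pverts G, parcs = parcs G - {(a, b), (b, a)}\<rparr>"
  interpret H: pair_wf_digraph H
    by unfold_locales (auto simp: H_def dest: in_arcsD1 in_arcsD2)
  obtain k where "(b, a) \<in> parcs H ^^ k"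
    using \<open>(b, a) \<in> _\<close> by (auto simp: H_def dest: rtrancl_imp_relpow)
  then obtain q where "H.awalk b q a"
    using relpow_imp_awalk[OF H.pair_wf_digraph_axioms, of b a k] in_arcsD2[OF ab] by (auto simp: H_def)
  then obtain p where p: "H.apath b p a" using H.apath_awalk_to_apath by blast
  have arcs: "set p \<subseteq> parcs G - {(a, b), (b, a)}" and cas: "pcas b p a"
    and dist: "distinct (pawalk_verts b p)"
    using p unfolding H.apath_def H.awalk_def by (auto simp: H_def)
  have walk: "awalk a ((a, b) # p) a"
    using arcs cas ab in_arcsD1[OF ab] unfolding awalk_def by auto
  have "cycle ((a, b) # p)"
    unfolding cycle_def using walk dist by (intro exI[of _ a]) simp
  \<comment> \<open>The path is neither empty, as there are no loops, nor the single arc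
    \<open>(b, a)\<close>, which was deleted.\<close>
  moreover have "3 \<le> length ((a, b) # p)"
  proof (rule ccontr)
    assume "\<not> 3 \<le> length ((a, b) # p)"
    then have "p = [] \<or> (\<exists>e. p = [e])" by (cases p; cases "tl p") auto
    then show False using cas arcs pair_no_loops[OF ab] by auto
  qed
  ultimately show False using T unfolding is_tree_def by blast
qed

text \<open>Breadth-first search from \<open>u\<close>: \<open>depth\<close> is the length of a
  shortest walk and \<open>parent\<close> a predecessor on one. The parent edges already connect
  everything, so a further edge would fail to be a bridge.\<close>

lemma is_tree_rooted:
  assumes T: "is_tree G" and u: "u \<in> pverts G"
  obtains parent depth where "rooted_tree (pverts G) u parent depth"
    "parcs G = (\<lambda>w. (w, parent w)) ` (pverts G - {u}) \<union> (\<lambda>w. (parent w, w)) ` (pverts G - {u})"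
    "\<And>w. w \<in> pverts G \<Longrightarrow> (u, w) \<in> parcs G ^^ depth w"
proof -
  interpret pair_graph G using T by (simp add: is_tree_def)
  let ?A = "parcs G" and ?V = "pverts G"
  define depth where "depth w = (LEAST k. (u, w) \<in> ?A ^^ k)" for w
  have depth: "(u, w) \<in> ?A ^^ depth w" if "w \<in> ?V" for w
    using rtrancl_imp_relpow[OF is_tree_rtrancl[OF T u that]] unfolding depth_def
    by (auto intro: LeastI)
  have depth_le: "depth w \<le> k" if "(u, w) \<in> ?A ^^ k" for w k
    using that unfolding depth_def by (rule Least_le)
  have "\<exists>z. (z, w) \<in> ?A \<and> depth w = Suc (depth z)" if w: "w \<in> ?V" "w \<noteq> u" for w
  proof -
    have "depth w \<noteq> 0" using depth[OF w(1)] w(2) by (auto intro: Nat.gr0I)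
    then obtain m where m: "depth w = Suc m" using not0_implies_Suc by blast
    then obtain z where z: "(u, z) \<in> ?A ^^ m" "(z, w) \<in> ?A"
      using depth[OF w(1)] by auto
    have "(u, w) \<in> ?A ^^ Suc (depth z)" using depth in_arcsD1[OF z(2)] z(2) by auto
    then have "depth w = Suc (depth z)" using depth_le[OF z(1)] depth_le[of w] m by fastforce
    then show ?thesis using z by blast
  qed
  then obtain parent where
    parent: "\<And>w. w \<in> ?V \<Longrightarrow> w \<noteq> u \<Longrightarrow> (parent w, w) \<in> ?A \<and> depth w = Suc (depth (parent w))"
    by metis
  have "depth u = 0" using depth_le[of u 0] by simp
  then have rooted: "rooted_tree ?V u parent depth"
    using parent u in_arcsD1 pair_finite_verts by unfold_locales blast+
  define B where "B = (\<lambda>w. (w, parent w)) ` (?V - {u}) \<union> (\<lambda>w. (parent w, w)) ` (?V - {u})"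
  have BA: "B \<subseteq> ?A" unfolding B_def using parent arcs_symmetric by auto
  have symB: "sym B" unfolding B_def by (auto simp: sym_def)
  have toB: "(w, u) \<in> B\<^sup>*" if "w \<in> ?V" for w
    using that
  proof (induction "depth w" arbitrary: w rule: less_induct)
    case less
    show ?case
    proof (cases "w = u")
      case False
      then have "(w, parent w) \<in> B" "depth (parent w) < depth w" "parent w \<in> ?V"
        using less.prems parent[of w] in_arcsD1 unfolding B_def by auto
      then show ?thesis using less.hyps by (meson converse_rtrancl_into_rtrancl)
    qed simp
  qed
  have "?A \<subseteq> B"
  proof (rule subrelI, rule ccontr)
    fix a b assume ab: "(a, b) \<in> ?A" "(a, b) \<notin> B"
    have "(b, u) \<in> B\<^sup>*" "(u, a) \<in> B\<^sup>*"
      using toB in_arcsD1[OF ab(1)] in_arcsD2[OF ab(1)] symD[OF sym_rtrancl[OF symB]] by auto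
    then have "(b, a) \<in> B\<^sup>*" by simp
    moreover have "B \<subseteq> ?A - {(a, b), (b, a)}" using BA ab(2) symB by (auto dest: symD)
    ultimately show False using is_tree_bridge[OF T ab(1)] rtrancl_mono by blast
  qed
  then show ?thesis using that[OF rooted] depth BA unfolding B_def by blast
qed

section \<open>A tree of prescribed order and diameter\<close>

lemma sym_relpow_swap: "sym r \<Longrightarrow> (x, y) \<in> r ^^ k \<Longrightarrow> (y, x) \<in> r ^^ k"
proof (induction k arbitrary: y)
  case (Suc k)
  then obtain z where "(x, z) \<in> r ^^ k" "(z, y) \<in> r" by auto
  then show ?case using Suc by (meson relpow_Suc_I2 symD)
qed simp

lemma pcas_nth: "pcas u p v \<Longrightarrow> Suc i < length p \<Longrightarrow> snd (p ! i) = fst (p ! Suc i)"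
proof (induction p arbitrary: u i)
  case (Cons e p)
  then show ?case by (cases i; cases p) auto
qed simp

lemma pcas_last: "pcas u p v \<Longrightarrow> p \<noteq> [] \<Longrightarrow> fst (hd p) = u \<and> snd (last p) = v"
proof (induction p arbitrary: u)
  case (Cons e p)
  then show ?case by (cases p) auto
qed simp

lemma pawalk_verts_tl: "tl (pawalk_verts u p) = (if p = [] then [] else map snd p)" if "pcas u p v"
  using that
proof (induction p arbitrary: u)
  case (Cons e p)
  then show ?case by (cases p) auto
qed simp

text \<open>The two neighbours of the largest vertex of a cycle are both smaller than it.\<close>

lemma no_long_cycle:
  fixes G :: "'a::linorder pair_pre_digraph"
  assumes G: "pair_graph G"
    and uniq: "\<And>w y z. (w, y) \<in> parcs G \<Longrightarrow> (w, z) \<in> parcs G \<Longrightarrow> y < w \<Longrightarrow> z < w \<Longrightarrow> y = z"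
    and cyc: "pre_digraph.cycle (with_proj G) p"
  shows "length p < 3"
proof (rule ccontr)
  assume len: "\<not> length p < 3"
  interpret pair_graph G by fact
  obtain u where walk: "awalk u p u" and dist: "distinct (tl (pawalk_verts u p))" and ne: "p \<noteq> []"
    using cyc unfolding cycle_def by auto
  have arcs: "set p \<subseteq> parcs G" and cas: "pcas u p u" using walk by (auto simp: awalk_def)
  define L where "L = length p"
  have L: "3 \<le> L" using len by (simp add: L_def)
  \<comment> \<open>The heads of the arcs list each vertex of the cycle once.\<close>
  define x where "x i = snd (p ! i)" for i
  have inj: "x i \<noteq> x j" if "i < L" "j < L" "i \<noteq> j" for i j
    using dist ne that unfolding pawalk_verts_tl[OF cas] x_def L_def
    by (auto simp: distinct_conv_nth)
  have step: "(x i, x (Suc i)) \<in> parcs G" if "Suc i < L" for i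
    using pcas_nth[OF cas, of i] arcs nth_mem[of "Suc i" p] that unfolding x_def L_def by auto
  have wrap: "(x (L - 1), x 0) \<in> parcs G"
  proof -
    have "x (L - 1) = fst (p ! 0)"
      using pcas_last[OF cas ne] ne unfolding x_def L_def by (simp add: hd_conv_nth last_conv_nth)
    then show ?thesis using arcs nth_mem[of 0 p] ne unfolding x_def by auto
  qed
  obtain j where j: "j < L" "\<And>i. i < L \<Longrightarrow> x i \<le> x j"
  proof -
    have "Max (x ` {..<L}) \<in> x ` {..<L}" using L by (intro Max_in) (auto simp: lessThan_empty_iff)
    then obtain j where "j < L" "x j = Max (x ` {..<L})" by auto
    then show ?thesis using that by simp
  qed
  have lt: "x i < x j" if "i < L" "i \<noteq> j" for i using j inj[of i j] that by (simp add: order.strict_iff_order)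
  have contra: False
    if "a < L" "b < L" "a \<noteq> b" "a \<noteq> j" "b \<noteq> j" "(x j, x a) \<in> parcs G" "(x j, x b) \<in> parcs G" for a b
    using uniq[of "x j" "x a" "x b"] lt inj that by blast
  \<comment> \<open>The cyclic neighbours of position \<open>j\<close> wrap around in the first two
    cases; they are distinct positions because \<open>L \<ge> 3\<close>.\<close>
  consider "j = 0" | "j = L - 1" "j \<noteq> 0" | "0 < j" "Suc j < L" using j(1) by linarith
  then show False
  proof cases
    case 1
    then show False using contra[of 1 "L - 1"] step[of 0] arcs_symmetric[OF wrap] L 1 by fastforce
  next
    case 2
    have "(x (L - 2), x j) \<in> parcs G"
      using step[of "L - 2"] 2 L by (simp add: numeral_2_eq_2 Suc_diff_Suc)
    moreover have "L - 2 \<noteq> j" "0 \<noteq> L - 2" "L - 2 < L" "0 < L" using 2 L by linarith+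
    ultimately show False
      using contra[of 0 "L - 2"] wrap arcs_symmetric 2 by metis
  next
    case 3
    then have "(x (j - 1), x j) \<in> parcs G" using step[of "j - 1"] by simp
    moreover have "j - 1 \<noteq> j" "Suc j \<noteq> j - 1" "j - 1 < L" using 3 by linarith+
    ultimately show False
      using contra[of "Suc j" "j - 1"] step[of j] arcs_symmetric 3 by simp
  qed
qed

text \<open>For \<open>2 \<le> d < n\<close> this is the path on \<open>0, ..., d - 1\<close> with
  all vertices from \<open>d\<close> on attached as leaves to \<open>d - 1\<close>. It serves to
  show that the set under \<open>Max\<close> is nonempty.\<close>

definition broom :: "nat \<Rightarrow> nat \<Rightarrow> nat pair_pre_digraph" where
  "broom n d = \<lparr>pverts = {0..<n},
     parcs = (\<lambda>w. (w, min (w - 1) (d - 1))) ` {1..<n} \<union> (\<lambda>w. (min (w - 1) (d - 1), w)) ` {1..<n}\<rparr>"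

text \<open>Each vertex has at most one smaller neighbour, so there is no long cycle. Explicit walks
  bound the diameter above, and the distance from \<open>0\<close> to \<open>d\<close> bounds it
  below.\<close>

lemma broom_in_trees:
  assumes d: "2 \<le> d" and dn: "d < n"
  shows "broom n d \<in> trees n d"
proof -
  let ?G = "broom n d"
  have verts: "pverts ?G = {0..<n}" by (simp add: broom_def)
  have arcs_iff: "(x, y) \<in> parcs ?G \<longleftrightarrow>
      (1 \<le> x \<and> x < n \<and> y = min (x - 1) (d - 1)) \<or> (1 \<le> y \<and> y < n \<and> x = min (y - 1) (d - 1))" for x y
    by (auto simp: broom_def)
  have sym: "sym (parcs ?G)" by (auto simp: sym_def arcs_iff)
  interpret pair_graph ?G
  proof unfold_locales
    show "finite (pverts ?G)" "finite (parcs ?G)" by (simp_all add: broom_def)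
    show "symmetric (with_proj ?G)" using sym by (simp add: symmetric_def)
  next
    fix e assume "e \<in> parcs ?G"
    then show "fst e \<in> pverts ?G" "snd e \<in> pverts ?G" "fst e \<noteq> snd e"
      by (cases e; auto simp: arcs_iff verts)+
  qed
  have wf: "pair_wf_digraph ?G" by (rule pair_wf_digraph)
  \<comment> \<open>\<open>min j d\<close> is the level of \<open>j\<close>: all leaves at
    \<open>d - 1\<close> have level \<open>d\<close>.\<close>
  have down: "(j, i) \<in> parcs ?G ^^ (min j d - i)" if "i \<le> j" "i \<le> d - 1" "j < n" for i j
    using that
  proof (induction j rule: less_induct)
    case (less j)
    show ?case
    proof (cases "i = j")
      case True
      then show ?thesis using less.prems d by simp
    next
      case False
      define y where "y = min (j - 1) (d - 1)"
      have y: "(j, y) \<in> parcs ?G" "y < j" "i \<le> y" "y < n" "min j d - i = Suc (min y d - i)"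
        using False less.prems d by (auto simp: arcs_iff y_def)
      then show ?thesis using less.IH[of y] less.prems by (metis relpow_Suc_I2)
    qed
  qed
  have close: "\<exists>k\<le>d. (j, i) \<in> parcs ?G ^^ k" if "i \<le> j" "j < n" for i j
  proof (cases "i \<le> d - 1 \<or> i = j")
    case True
    then show ?thesis
    proof (elim disjE)
      assume "i \<le> d - 1"
      then show ?thesis using down[of i j] that by (intro exI[of _ "min j d - i"]) auto
    qed (auto intro: exI[of _ 0])
  next
    case False
    \<comment> \<open>Here \<open>i\<close> and \<open>j\<close> are distinct leaves at
      \<open>d - 1\<close>, two steps apart; this uses \<open>2 \<le> d\<close>.\<close>
    then have "(j, d - 1) \<in> parcs ?G" "(d - 1, i) \<in> parcs ?G" using that by (auto simp: arcs_iff)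
    then have "(j, i) \<in> parcs ?G ^^ 2" by (auto simp: numeral_2_eq_2)
    then show ?thesis using d by blast
  qed
  have close': "\<exists>k\<le>d. (u, v) \<in> parcs ?G ^^ k" if "u < n" "v < n" for u v
    using close[of u v] close[of v u] that sym_relpow_swap[OF sym] by (meson nat_le_linear)
  have conn: "Digraph_Component.connected (with_proj ?G)"
  proof -
    have "u \<rightarrow>\<^sup>*\<^bsub>with_proj ?G\<^esub> v" if uv: "u < n" "v < n" for u v
    proof -
      obtain k where "(u, v) \<in> parcs ?G ^^ k" using close'[OF uv] by blast
      then show ?thesis using relpow_imp_awalk[OF wf, of u v k] uv
        by (auto simp: reachable_awalk verts)
    qed
    then show ?thesis
      using dn unfolding connected_def strongly_connected_def
      by (auto simp: verts reachable_mk_symmetric_eq[OF pair_sym_arcs])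
  qed
  have "is_tree ?G"
    unfolding is_tree_def
  proof (intro conjI conn pair_graph notI)
    assume "\<exists>p. cycle p \<and> 3 \<le> length p"
    then obtain p where "cycle p" "3 \<le> length p" by blast
    moreover have "length p < 3" if "cycle p" for p
      using that by (rule no_long_cycle[OF pair_graph, rotated]) (unfold arcs_iff, linarith)
    ultimately show False by (meson not_le)
  qed
  moreover have "diameter ?G = ereal (real d)"
  proof (rule antisym)
    show "diameter ?G \<le> ereal (real d)"
      unfolding diameter_def
    proof (intro SUP_least)
      fix u v assume uv: "u \<in> pverts ?G" "v \<in> pverts ?G"
      then obtain k where k: "k \<le> d" "(u, v) \<in> parcs ?G ^^ k" using close'[of u v] by (auto simp: verts)
      have "distance ?G u v \<le> ereal (real k)" by (rule distance_le[OF wf uv(1) k(2)])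
      also have "\<dots> \<le> ereal (real d)" using k by simp
      finally show "distance ?G u v \<le> ereal (real d)" .
    qed
    \<comment> \<open>The level grows by at most one along an arc.\<close>
    have "min w d \<le> k" if "(0, w) \<in> parcs ?G ^^ k" for w k
      using that
    proof (induction k arbitrary: w)
      case (Suc k)
      then obtain z where "(0, z) \<in> parcs ?G ^^ k" "(z, w) \<in> parcs ?G" by auto
      then show ?case using Suc.IH[of z] by (auto simp: arcs_iff)
    qed simp
    from this[of d] have "ereal (real d) \<le> distance ?G 0 d" by (intro distance_ge[OF wf]) simp
    also have "\<dots> \<le> (SUP v\<in>pverts ?G. distance ?G 0 v)" using dn by (intro SUP_upper) (simp add: verts)
    also have "\<dots> \<le> diameter ?G" using dn unfolding diameter_def by (intro SUP_upper) (simp add: verts)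
    finally show "ereal (real d) \<le> diameter ?G" .
  qed
  ultimately show ?thesis by (simp add: trees_def verts)
qed

section \<open>The bound on trees\<close>

lemma adjacency_form:
  fixes x :: "real vec"
  assumes V: "pverts G = {0..<n}" and arcs: "parcs G \<subseteq> {0..<n} \<times> {0..<n}" and x: "x \<in> carrier_vec n"
  shows "x \<bullet> (adjacency_matrix G *\<^sub>v x) = (\<Sum>(i, j)\<in>parcs G. x $ i * x $ j)"
proof -
  have "x \<bullet> (adjacency_matrix G *\<^sub>v x)
      = (\<Sum>i\<in>{0..<n}. \<Sum>j\<in>{0..<n}. if (i, j) \<in> parcs G then x $ i * x $ j else 0)"
    using x by (auto simp: scalar_prod_def adjacency_matrix_def V sum_distrib_left intro!: sum.cong)
  also have "\<dots> = (\<Sum>(i, j)\<in>{0..<n} \<times> {0..<n}. if (i, j) \<in> parcs G then x $ i * x $ j else 0)"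
    by (simp add: sum.cartesian_product)
  also have "\<dots> = (\<Sum>(i, j)\<in>parcs G. x $ i * x $ j)"
    using arcs by (intro sum.mono_neutral_cong_right) auto
  finally show ?thesis .
qed

lemma lambda2_tree_le:
  assumes T: "T \<in> trees n d" and n: "2 \<le> n" and K: "real n - real d - 1 \<le> 2 * K" "0 \<le> K"
  shows "lambda2 T \<le> sqrt (2 + sqrt (K\<^sup>2 + 4))"
proof -
  have V: "pverts T = {0..<n}" and tree: "is_tree T" and diam: "diameter T = ereal (real d)"
    using T by (auto simp: trees_def)
  interpret pair_graph T using tree by (simp add: is_tree_def)
  define \<mu> where "\<mu> = sqrt (2 + sqrt (K\<^sup>2 + 4))"
  obtain t where t: "0 < t" "1 / t + t = \<mu>" "1 / t - t = K / \<mu>"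
    using decay_rate_exists(1)[OF K(2)] unfolding \<mu>_def by blast
  have \<mu>: "0 < \<mu>" "K \<le> \<mu>\<^sup>2" using decay_rate_exists(2,3)[OF K(2)] by (simp_all add: \<mu>_def)
  obtain u v where uv: "u \<in> pverts T" "v \<in> pverts T" "distance T u v = diameter T"
  proof (rule diameter_attained)
    show "finite (pverts T)" "pverts T \<noteq> {}" using V n by auto
  qed
  obtain parent depth where rooted: "rooted_tree (pverts T) u parent depth"
    and arcs: "parcs T = (\<lambda>w. (w, parent w)) ` (pverts T - {u}) \<union> (\<lambda>w. (parent w, w)) ` (pverts T - {u})"
    and depth: "\<And>w. w \<in> pverts T \<Longrightarrow> (u, w) \<in> parcs T ^^ depth w"
    by (rule is_tree_rooted[OF tree uv(1)]) (rule that)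
  interpret rooted_tree "pverts T" u parent depth by (rule rooted)
  let ?E = "pverts T - {u}"
  \<comment> \<open>\<open>depth v\<close> is the length of a walk from \<open>u\<close> to
    \<open>v\<close>, hence at least their distance. So \<open>P\<close> has at least
    \<open>d + 1\<close> vertices, leaving at most \<open>n - d - 1\<close> off it.\<close>
  have "ereal (real d) \<le> ereal (real (depth v))"
    using distance_le[OF pair_wf_digraph uv(1) depth[OF uv(2)]] uv(3) diam by simp
  then have dv: "d \<le> depth v" by simp
  obtain P where P: "P \<subseteq> pverts T" "\<And>w. w \<in> P \<Longrightarrow> w \<noteq> u \<Longrightarrow> parent w \<in> P"
      "inj_on parent (P - {u})" "depth v < card P"
    by (rule root_path[OF uv(2)]) (rule that)
  have "card (pverts T - P) = n - card P" "card P \<le> n"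
    using P(1) V card_mono[of "{0..<n}" P] by (auto simp: card_Diff_subset finite_subset)
  then have "real (card (pverts T - P)) \<le> 2 * K" using dv P(4) K(1) by linarith
  then obtain c where c: "c \<in> pverts T" "\<And>x. x c = 0 \<Longrightarrow>
      2 * (\<Sum>w\<in>?E. x w * x (parent w)) \<le> \<mu> * (\<Sum>v\<in>pverts T. (x v)\<^sup>2)"
    using edge_form_le_without_centroid[OF P(1-3) _ t(1) \<mu>(1) t(2,3) \<mu>(2)] by blast
  let ?A = "adjacency_matrix T"
  have A: "?A \<in> carrier_mat n n" by (simp add: adjacency_matrix_def V)
  have sym: "transpose_mat ?A = ?A"
  proof (rule eq_matI)
    fix i j assume "i < dim_row ?A" "j < dim_col ?A"
    moreover have "(i, j) \<in> parcs T \<longleftrightarrow> (j, i) \<in> parcs T" using arcs_symmetric by blast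
    ultimately show "transpose_mat ?A $$ (i, j) = ?A $$ (i, j)"
      by (simp add: adjacency_matrix_def V)
  qed (simp_all add: adjacency_matrix_def)
  have "x \<bullet> (?A *\<^sub>v x) \<le> \<mu> * (x \<bullet> x)" if x: "x \<in> carrier_vec n" "x $ c = 0" for x
  proof -
    \<comment> \<open>Upward and downward arcs are disjoint, since two vertices cannot be each
      other's parent. Each edge thus counts exactly twice in the form.\<close>
    have disj: "(\<lambda>w. (w, parent w)) ` ?E \<inter> (\<lambda>w. (parent w, w)) ` ?E = {}"
    proof (rule equals0I)
      fix e assume "e \<in> (\<lambda>w. (w, parent w)) ` ?E \<inter> (\<lambda>w. (parent w, w)) ` ?E"
      then obtain a b where ab: "a \<in> ?E" "b \<in> ?E" "e = (a, parent a)" "e = (parent b, b)" by blast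
      have "depth (parent a) < depth a" "depth (parent b) < depth b"
        using ab(1,2) depth_parent by blast+
      moreover have "parent a = b" "parent b = a" using ab(3,4) by blast+
      ultimately show False by simp
    qed
    have "x \<bullet> (?A *\<^sub>v x) = (\<Sum>(i, j)\<in>parcs T. x $ i * x $ j)"
    proof (rule adjacency_form[OF V _ x(1)])
      show "parcs T \<subseteq> {0..<n} \<times> {0..<n}"
        unfolding V[symmetric] by (rule subrelI) (blast intro: in_arcsD1 in_arcsD2)
    qed
    also have "\<dots> = (\<Sum>(i, j)\<in>(\<lambda>w. (w, parent w)) ` ?E. x $ i * x $ j)
        + (\<Sum>(i, j)\<in>(\<lambda>w. (parent w, w)) ` ?E. x $ i * x $ j)"
      unfolding arcs using disj pair_finite_verts by (intro sum.union_disjoint) auto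
    also have "\<dots> = 2 * (\<Sum>w\<in>?E. x $ w * x $ parent w)"
    proof -
      have "inj_on (\<lambda>w. (w, parent w)) ?E" "inj_on (\<lambda>w. (parent w, w)) ?E"
        by (auto simp: inj_on_def)
      then have "(\<Sum>(i, j)\<in>(\<lambda>w. (w, parent w)) ` ?E. x $ i * x $ j) = (\<Sum>w\<in>?E. x $ w * x $ parent w)"
        "(\<Sum>(i, j)\<in>(\<lambda>w. (parent w, w)) ` ?E. x $ i * x $ j) = (\<Sum>w\<in>?E. x $ w * x $ parent w)"
        by (simp_all only: sum.reindex o_def prod.case) (rule sum.cong[OF refl mult.commute])
      then show ?thesis by linarith
    qed
    also have "\<dots> \<le> \<mu> * (\<Sum>v\<in>pverts T. (x $ v)\<^sup>2)" using c(2)[of "\<lambda>v. x $ v"] x(2) by simp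
    also have "(\<Sum>v\<in>pverts T. (x $ v)\<^sup>2) = x \<bullet> x"
      using x(1) by (simp add: scalar_prod_def V power2_eq_square)
    finally show ?thesis .
  qed
  then have "eigenvalues_desc ?A ! 1 \<le> \<mu>"
    using c(1) V by (intro second_eigenvalue_le[OF A sym n, of c]) simp_all
  then show ?thesis by (simp add: lambda2_def \<mu>_def)
qed

theorem corollary1p1:
  fixes n d :: nat
  assumes "n \<ge> 4" and "3 \<le> d" and "d \<le> n - 2"
  shows "lambda2_star n d < sqrt (2 + sqrt (((real n - real d) / 2)\<^sup>2 + 4))"
proof -
  \<comment> \<open>A path of length \<open>d\<close> has \<open>d + 1\<close> vertices; the
    resulting loss of \<open>1 / 2\<close> against \<open>(n - d) / 2\<close> makes the inequality
    strict.\<close>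
  define K where "K = (real n - real d - 1) / 2"
  have K: "0 \<le> K" "real n - real d - 1 \<le> 2 * K" "K < (real n - real d) / 2"
    using assms by (auto simp: K_def)
  have "K\<^sup>2 < ((real n - real d) / 2)\<^sup>2" using K by (intro power_strict_mono) auto
  then have less: "sqrt (2 + sqrt (K\<^sup>2 + 4)) < sqrt (2 + sqrt (((real n - real d) / 2)\<^sup>2 + 4))" by simp
  \<comment> \<open>With finiteness and nonemptiness, a strict bound on every element passes to
    \<open>Max\<close>.\<close>
  have "finite {lambda2 T | T. T \<in> trees n d}" using finite_trees by simp
  moreover have "broom n d \<in> trees n d" using assms by (intro broom_in_trees) auto
  then have "{lambda2 T | T. T \<in> trees n d} \<noteq> {}" by blast
  moreover have "lambda2 T < sqrt (2 + sqrt (((real n - real d) / 2)\<^sup>2 + 4))" if "T \<in> trees n d" for T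
    using lambda2_tree_le[OF that _ K(2,1)] assms(1) less by linarith
  ultimately show ?thesis unfolding lambda2_star_def by auto
qed

end
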